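(* For every $n\ge1$ and every Boolean function $f:\{0,1\}^n\to\{0,1\}$, $\mathsf{EC}(f)\le 3n-1$.
   Context: A Boolean circuit $C$ over the basis $\mathcal{B}=\{\land_2,\lor_2,\lnot\}$ (AND and OR of fan-in 2, and NOT) is a directed acyclic graph with a root node of out-degree zero, input gates (in-degree zero) labeled by variables $x_1,\dots,x_n$, and non-input gates (including the root) labeled by functions in $\mathcal{B}$; gates may have arbitrary fan-out. For $a\in\{0,1\}^n$, $\mathsf{EC}(C,a)$ is the number of non-input gates of $C$ that output $1$ on $a$; $\mathsf{EC}(C)=\max_a\mathsf{EC}(C,a)$; $\mathsf{EC}(f)$ is the minimum of $\mathsf{EC}(C)$ over all circuits $C$ over $\mathcal{B}$ computing $f$. *)

theory Defs
  imports "HOL-Library.Extended_Nat"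
begin

text \<open>A gate carries its label together with the tails of its incoming edges. The two
  predecessors of a binary gate may coincide (parallel edges). \<open>Input i\<close> is labelled by the
  variable $x_{i+1}$. The set function \<open>preds\<close> gives the predecessors.\<close>

datatype (preds: 'v) gate =
    is_input: Input nat
  | GAnd 'v 'v
  | GOr 'v 'v
  | GNot 'v

record 'v circuit =
  nodes :: "'v set"
  root :: 'v
  gate :: "'v \<Rightarrow> 'v gate"

definition edges :: "'v circuit \<Rightarrow> ('v \<times> 'v) set" where
  "edges C = {(u, v). v \<in> nodes C \<and> u \<in> preds (gate C v)}"

definition is_circuit :: "nat \<Rightarrow> 'v circuit \<Rightarrow> bool" where
  "is_circuit n C \<longleftrightarrow>
     finite (nodes C) \<and>
     edges C \<subseteq> nodes C \<times> nodes C \<and>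
     acyclic (edges C) \<and>
     (\<forall>v\<in>nodes C. \<forall>i. gate C v = Input i \<longrightarrow> i < n) \<and>
     root C \<in> nodes C \<and>
     \<not> is_input (gate C (root C)) \<and>
     (\<forall>v. (root C, v) \<notin> edges C)"

text \<open>\<open>outputs C a v b\<close>: on input \<open>a\<close>, node \<open>v\<close> outputs \<open>b\<close>. In a circuit every node has
  exactly one output, see \<open>outputs_ex1\<close>.\<close>

inductive outputs :: "'v circuit \<Rightarrow> bool list \<Rightarrow> 'v \<Rightarrow> bool \<Rightarrow> bool"
  for C :: "'v circuit" and a :: "bool list" where
  out_Input: "gate C v = Input i \<Longrightarrow> outputs C a v (a ! i)"
| out_And: "gate C v = GAnd u w \<Longrightarrow> outputs C a u p \<Longrightarrow> outputs C a w q \<Longrightarrow> outputs C a v (p \<and> q)"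
| out_Or: "gate C v = GOr u w \<Longrightarrow> outputs C a u p \<Longrightarrow> outputs C a w q \<Longrightarrow> outputs C a v (p \<or> q)"
| out_Not: "gate C v = GNot u \<Longrightarrow> outputs C a u p \<Longrightarrow> outputs C a v (\<not> p)"

lemma outputs_unique: "outputs C a v b \<Longrightarrow> outputs C a v b' \<Longrightarrow> b' = b"
proof (induction arbitrary: b' rule: outputs.induct)
  case (out_Input v i)
  from out_Input.prems show ?case
    by cases (use out_Input.hyps in simp_all)
next
  case (out_And v u w p q)
  note IH = out_And.IH
  from out_And.prems show ?case
  proof cases
    case (out_And u' w' p' q')
    with \<open>gate C v = GAnd u w\<close> have "outputs C a u p'" "outputs C a w q'" by simp_all
    with IH out_And show ?thesis by blast
  qed (use \<open>gate C v = GAnd u w\<close> in simp_all)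
next
  case (out_Or v u w p q)
  note IH = out_Or.IH
  from out_Or.prems show ?case
  proof cases
    case (out_Or u' w' p' q')
    with \<open>gate C v = GOr u w\<close> have "outputs C a u p'" "outputs C a w q'" by simp_all
    with IH out_Or show ?thesis by blast
  qed (use \<open>gate C v = GOr u w\<close> in simp_all)
next
  case (out_Not v u p)
  note IH = out_Not.IH
  from out_Not.prems show ?case
  proof cases
    case (out_Not u' p')
    with \<open>gate C v = GNot u\<close> have "outputs C a u p'" by simp
    with IH out_Not show ?thesis by blast
  qed (use \<open>gate C v = GNot u\<close> in simp_all)
qed

lemma outputs_ex1:
  assumes "is_circuit n C" and "v \<in> nodes C"
  shows "\<exists>!b. outputs C a v b"
proof -
  have "finite (edges C)"
    using assms(1) finite_subset[of "edges C" "nodes C \<times> nodes C"] by (simp add: is_circuit_def)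
  then have "wf (edges C)"
    using assms(1) by (simp add: finite_acyclic_wf is_circuit_def)
  then have "v \<in> nodes C \<longrightarrow> (\<exists>b. outputs C a v b)"
  proof (induction v rule: wf_induct_rule)
    case (less v)
    show ?case
    proof
      assume v: "v \<in> nodes C"
      have *: "\<exists>b. outputs C a u b" if "u \<in> preds (gate C v)" for u
      proof -
        have "(u, v) \<in> edges C" using v that by (simp add: edges_def)
        moreover from this have "u \<in> nodes C" using assms(1) by (auto simp: is_circuit_def)
        ultimately show ?thesis using less by blast
      qed
      show "\<exists>b. outputs C a v b"
      proof (cases "gate C v")
        case (Input i)
        then show ?thesis by (blast intro: outputs.intros)
      next
        case (GAnd u w)
        with * have "\<exists>b. outputs C a u b" "\<exists>b. outputs C a w b" by simp_all
        with GAnd show ?thesis by (blast intro: outputs.intros)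
      next
        case (GOr u w)
        with * have "\<exists>b. outputs C a u b" "\<exists>b. outputs C a w b" by simp_all
        with GOr show ?thesis by (blast intro: outputs.intros)
      next
        case (GNot u)
        with * have "\<exists>b. outputs C a u b" by simp
        with GNot show ?thesis by (blast intro: outputs.intros)
      qed
    qed
  qed
  then show ?thesis using assms(2) outputs_unique by metis
qed

definition computes :: "nat \<Rightarrow> 'v circuit \<Rightarrow> (bool list \<Rightarrow> bool) \<Rightarrow> bool" where
  "computes n C f \<longleftrightarrow> (\<forall>a. length a = n \<longrightarrow> outputs C a (root C) (f a))"

definition EC_at :: "'v circuit \<Rightarrow> bool list \<Rightarrow> nat" where
  "EC_at C a = card {v \<in> nodes C. \<not> is_input (gate C v) \<and> outputs C a v True}"

definition EC_circuit :: "nat \<Rightarrow> 'v circuit \<Rightarrow> nat" where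
  "EC_circuit n C = Max {EC_at C a | a. length a = n}"

text \<open>The energy complexity of the restriction of \<open>f\<close> to the Boolean vectors of length \<open>n\<close>.
  Nodes are natural numbers, which represents every finite circuit up to isomorphism. The infimum
  is taken in \<open>enat\<close>, so it is a minimum unless no circuit computes \<open>f\<close>, in which
  case it is \<open>\<infinity>\<close>.\<close>

definition EC :: "nat \<Rightarrow> (bool list \<Rightarrow> bool) \<Rightarrow> enat" where
  "EC n f = Inf {enat (EC_circuit n C) | C :: nat circuit. is_circuit n C \<and> computes n C f}"

end

theory Submission
  imports Defs
begin

text \<open>For every prefix \<open>p\<close> of length at least 2 there is an AND gate testing whether the input starts
  with \<open>p\<close>, fed by the gate for \<open>butlast p\<close> and a literal; only the gates for the \<open>n - 1\<close> prefixes of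
  the actual input fire. A complete binary tree of OR gates collects the minterms of \<open>f\<close>, and there
  only the at most \<open>n\<close> gates on the path to the actual input fire. Together with at most \<open>n\<close> NOT gates
  this gives \<open>3n - 1\<close>. Leaves on which \<open>f\<close> is false are fed by the gate $x_1 \land \neg x_1$, which
  never fires.\<close>

subsection \<open>Renaming the nodes of a circuit\<close>

lemma preds_in_nodes:
  assumes "is_circuit n C" "v \<in> nodes C" "u \<in> preds (gate C v)"
  shows "u \<in> nodes C"
proof -
  have "(u, v) \<in> edges C" using assms by (simp add: edges_def)
  then show ?thesis using assms(1) by (auto simp: is_circuit_def)
qed

text \<open>\<open>EC\<close> ranges over circuits with nodes in \<open>nat\<close>, while the
  construction below has structured nodes; renaming bridges the two. Gates are looked up through
  \<open>inv_into\<close>, which is the right preimage when \<open>h\<close> is injective on the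
  nodes.\<close>

definition map_circuit :: "('v \<Rightarrow> 'w) \<Rightarrow> 'v circuit \<Rightarrow> 'w circuit" where
  "map_circuit h C = \<lparr>nodes = h ` nodes C, root = h (root C),
     gate = (\<lambda>w. map_gate h (gate C (inv_into (nodes C) h w)))\<rparr>"

lemma map_circuit_simps [simp]:
  "nodes (map_circuit h C) = h ` nodes C"
  "root (map_circuit h C) = h (root C)"
  by (simp_all add: map_circuit_def)

lemma gate_map_circuit [simp]:
  assumes "inj_on h (nodes C)" "v \<in> nodes C"
  shows "gate (map_circuit h C) (h v) = map_gate h (gate C v)"
  using assms by (simp add: map_circuit_def)

lemma is_input_map_gate [simp]: "is_input (map_gate h g) \<longleftrightarrow> is_input g"
  by (cases g) simp_all

lemma edges_map_circuit:
  assumes "inj_on h (nodes C)"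
  shows "edges (map_circuit h C) = map_prod h h ` edges C"
  using assms by (force simp: edges_def gate.set_map)

lemma is_circuit_map_circuit:
  assumes C: "is_circuit n C" and h: "inj_on h (nodes C)"
  shows "is_circuit n (map_circuit h C)"
proof -
  let ?g = "inv_into (nodes C) h"
  have sub: "edges C \<subseteq> nodes C \<times> nodes C" using C by (simp add: is_circuit_def)
  \<comment> \<open>Edges pull back along the inverse renaming, so a cycle, or an edge leaving the
    new root, would give one in \<open>C\<close>.\<close>
  have edge_inv: "(?g u, ?g v) \<in> edges C" if "(u, v) \<in> edges (map_circuit h C)" for u v
    using that sub h by (auto simp: edges_map_circuit)
  have "acyclic (edges (map_circuit h C))"
  proof (rule acyclicI, intro allI notI)
    fix x assume "(x, x) \<in> (edges (map_circuit h C))\<^sup>+"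
    moreover have "(?g x, ?g y) \<in> (edges C)\<^sup>+"
      if "(x, y) \<in> (edges (map_circuit h C))\<^sup>+" for y
      using that
    proof (induction rule: trancl_induct)
      case (base y)
      then show ?case using edge_inv by blast
    next
      case (step y z)
      then show ?case using edge_inv trancl_into_trancl by metis
    qed
    ultimately show False using C by (auto simp: is_circuit_def acyclic_def)
  qed
  moreover have "i < n" if "v \<in> nodes C" "map_gate h (gate C v) = Input i" for v i
    using that C by (cases "gate C v") (auto simp: is_circuit_def)
  moreover have "(h (root C), v) \<notin> edges (map_circuit h C)" for v
    using edge_inv[of "h (root C)" v] C h by (auto simp: is_circuit_def)
  ultimately show ?thesis
    using C h sub by (auto simp: is_circuit_def edges_map_circuit)
qed

lemma outputs_map_circuit:
  assumes "is_circuit n C" and h: "inj_on h (nodes C)"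
  shows "outputs C a v b \<Longrightarrow> v \<in> nodes C \<Longrightarrow> outputs (map_circuit h C) a (h v) b"
proof (induction rule: outputs.induct)
  case (out_Input v i)
  then show ?case using h by (simp add: outputs.out_Input)
next
  case (out_And v u w p q)
  then have "u \<in> nodes C" "w \<in> nodes C"
    by (auto intro: preds_in_nodes[OF assms(1)])
  with out_And h show ?case by (intro outputs.out_And) simp_all
next
  case (out_Or v u w p q)
  then have "u \<in> nodes C" "w \<in> nodes C"
    by (auto intro: preds_in_nodes[OF assms(1)])
  with out_Or h show ?case by (intro outputs.out_Or) simp_all
next
  case (out_Not v u p)
  then have "u \<in> nodes C"
    by (auto intro: preds_in_nodes[OF assms(1)])
  with out_Not h show ?case by (intro outputs.out_Not) simp_all
qed

text \<open>The converse follows from determinism: \<open>v\<close> has some output in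
  \<open>C\<close>, this output transfers to \<open>h v\<close>, and outputs are unique.\<close>

lemma outputs_map_circuit_iff:
  assumes "is_circuit n C" "inj_on h (nodes C)" "v \<in> nodes C"
  shows "outputs (map_circuit h C) a (h v) b \<longleftrightarrow> outputs C a v b"
proof
  assume b: "outputs (map_circuit h C) a (h v) b"
  obtain b' where b': "outputs C a v b'"
    using outputs_ex1[OF assms(1,3)] by blast
  have "b = b'"
    using outputs_unique[OF outputs_map_circuit[OF assms(1,2) b' assms(3)] b] .
  with b' show "outputs C a v b" by simp
qed (rule outputs_map_circuit[OF assms(1,2) _ assms(3)])

lemma EC_at_map_circuit:
  assumes "is_circuit n C" "inj_on h (nodes C)"
  shows "EC_at (map_circuit h C) a = EC_at C a"
proof -
  have "{w \<in> nodes (map_circuit h C). \<not> is_input (gate (map_circuit h C) w)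
            \<and> outputs (map_circuit h C) a w True}
      = h ` {v \<in> nodes C. \<not> is_input (gate C v) \<and> outputs C a v True}"
    using assms by (auto simp: outputs_map_circuit_iff)
  then show ?thesis
    using assms(2) unfolding EC_at_def
    by (simp add: card_image inj_on_subset[of h "nodes C"])
qed

lemma EC_le:
  fixes C :: "'v circuit"
  assumes C: "is_circuit n C" "computes n C f"
    and le: "\<And>a. length a = n \<Longrightarrow> EC_at C a \<le> k"
  shows "EC n f \<le> enat k"
proof -
  have "finite (nodes C)" using C by (simp add: is_circuit_def)
  then obtain h :: "'v \<Rightarrow> nat" where h: "inj_on h (nodes C)"
    using finite_imp_inj_to_nat_seg[of "nodes C"] by auto
  let ?D = "map_circuit h C"
  have "root C \<in> nodes C" using C by (simp add: is_circuit_def)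
  then have "computes n ?D f"
    using C h by (simp add: computes_def outputs_map_circuit_iff)
  with C h have "EC n f \<le> enat (EC_circuit n ?D)"
    unfolding EC_def by (intro Inf_lower) (auto intro: is_circuit_map_circuit)
  moreover have "EC_circuit n ?D \<le> k"
  proof -
    let ?S = "{EC_at ?D a | a. length a = n}"
    have "finite {a :: bool list. length a = n}"
      using finite_lists_length_eq[of "UNIV :: bool set" n] by simp
    then have "finite ?S" by simp
    \<comment> \<open>\<open>Max\<close> is meaningful only on a finite nonempty set; the all-false
      input is a witness.\<close>
    moreover have "?S \<noteq> {}" using length_replicate[of n False] by blast
    ultimately show ?thesis
      using C h le by (auto simp: EC_circuit_def EC_at_map_circuit)
  qed
  ultimately show ?thesis by (meson enat_ord_simps(1) order_trans)
qed

subsection \<open>The prefix tree circuit\<close>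

datatype node = Var nat | Neg nat | Zero | Prefix "bool list" | Result "bool list"

definition literal :: "nat \<Rightarrow> bool \<Rightarrow> node" where
  "literal i b = (if b then Var i else Neg i)"

text \<open>Testing a prefix of length 1 by a literal leaves only the lengths 2 to \<open>n\<close>
  for AND gates, which saves the one gate between \<open>3 * n\<close> and
  \<open>3 * n - 1\<close>.\<close>

definition prefix_node :: "bool list \<Rightarrow> node" where
  "prefix_node p = (if length p = 1 then literal 0 (hd p) else Prefix p)"

text \<open>Leaves of the OR tree are wired directly to existing nodes and so add no energy of their
  own.\<close>

definition result_node :: "nat \<Rightarrow> (bool list \<Rightarrow> bool) \<Rightarrow> bool list \<Rightarrow> node" where
  "result_node n f p =
     (if length p < n then Result p else if f p then prefix_node p else Zero)"

fun tree_gate :: "nat \<Rightarrow> (bool list \<Rightarrow> bool) \<Rightarrow> node \<Rightarrow> node gate" where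
  "tree_gate n f (Var i) = Input i"
| "tree_gate n f (Neg i) = GNot (Var i)"
| "tree_gate n f Zero = GAnd (Var 0) (Neg 0)"
| "tree_gate n f (Prefix p) = GAnd (prefix_node (butlast p)) (literal (length p - 1) (last p))"
| "tree_gate n f (Result p) = GOr (result_node n f (p @ [False])) (result_node n f (p @ [True]))"

fun is_node :: "nat \<Rightarrow> node \<Rightarrow> bool" where
  "is_node n (Var i) \<longleftrightarrow> i < n"
| "is_node n (Neg i) \<longleftrightarrow> i < n"
| "is_node n Zero \<longleftrightarrow> True"
| "is_node n (Prefix p) \<longleftrightarrow> 2 \<le> length p \<and> length p \<le> n"
| "is_node n (Result p) \<longleftrightarrow> length p < n"

definition tree_circuit :: "nat \<Rightarrow> (bool list \<Rightarrow> bool) \<Rightarrow> node circuit" where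
  "tree_circuit n f = \<lparr>nodes = {v. is_node n v}, root = Result [], gate = tree_gate n f\<rparr>"

lemma tree_circuit_simps [simp]:
  "nodes (tree_circuit n f) = {v. is_node n v}"
  "root (tree_circuit n f) = Result []"
  "gate (tree_circuit n f) = tree_gate n f"
  by (simp_all add: tree_circuit_def)

section \<open>Well-formedness of the prefix tree circuit\<close>

fun rank :: "nat \<Rightarrow> node \<Rightarrow> nat" where
  "rank n (Var i) = 0"
| "rank n (Neg i) = 1"
| "rank n Zero = 2"
| "rank n (Prefix p) = length p"
| "rank n (Result p) = 3 + 2 * n - length p"

text \<open>Prefixes grow along edges while the OR tree runs from long lists to short ones, hence
  the minus sign in \<open>rank\<close>; the offset \<open>3 + 2 * n\<close> keeps every
  \<open>Result\<close> node above \<open>Zero\<close> and all \<open>Prefix\<close> nodes. Literals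
  have rank at most 1, below any \<open>Prefix\<close> node. A \<open>Result\<close> predecessor has
  the form \<open>p @ [b]\<close>, so the root is never one.\<close>

lemma preds_tree_gate:
  assumes "n \<ge> 1" "is_node n v" "u \<in> preds (tree_gate n f v)"
  shows "is_node n u \<and> rank n u < rank n v \<and> u \<noteq> Result []"
  using assms
  by (cases v)
    (auto simp: result_node_def prefix_node_def literal_def Suc_le_eq split: if_splits)

lemma finite_is_node: "finite {v. is_node n v}"
proof -
  let ?L = "{p :: bool list. set p \<subseteq> UNIV \<and> length p \<le> n}"
  have "v \<in> Var ` {..<n} \<union> Neg ` {..<n} \<union> {Zero} \<union> Prefix ` ?L \<union> Result ` ?L"
    if "is_node n v" for v
    using that by (cases v) auto
  moreover have "finite ?L" by (rule finite_lists_length_le) simp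
  ultimately show ?thesis
    by (intro finite_subset[of "{v. is_node n v}" "Var ` {..<n} \<union> Neg ` {..<n} \<union> {Zero}
      \<union> Prefix ` ?L \<union> Result ` ?L"]) blast+
qed

lemma is_circuit_tree_circuit:
  assumes "n \<ge> 1"
  shows "is_circuit n (tree_circuit n f)"
proof -
  have "edges (tree_circuit n f) \<subseteq> measure (rank n)"
    using preds_tree_gate[OF assms] by (auto simp: edges_def)
  then have "acyclic (edges (tree_circuit n f))"
    by (meson wf_measure wf_acyclic acyclic_subset)
  moreover have "i < n" if "is_node n v" "tree_gate n f v = Input i" for v i
    using that by (cases v) auto
  moreover have "edges (tree_circuit n f) \<subseteq> {v. is_node n v} \<times> {v. is_node n v}"
    "(Result [], v) \<notin> edges (tree_circuit n f)" for v
    using preds_tree_gate[OF assms, of v "Result []" f] preds_tree_gate[OF assms]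
    by (auto simp: edges_def)
  ultimately show ?thesis
    using assms finite_is_node by (auto simp: is_circuit_def)
qed

section \<open>Gate values on a given input\<close>

fun node_value :: "(bool list \<Rightarrow> bool) \<Rightarrow> bool list \<Rightarrow> node \<Rightarrow> bool" where
  "node_value f a (Var i) = a ! i"
| "node_value f a (Neg i) = (\<not> a ! i)"
| "node_value f a Zero = False"
| "node_value f a (Prefix p) = (take (length p) a = p)"
| "node_value f a (Result p) = (take (length p) a = p \<and> f a)"

lemma node_value_literal [simp]: "node_value f a (literal i b) \<longleftrightarrow> a ! i = b"
  by (simp add: literal_def)

lemma node_value_prefix_node:
  assumes "p \<noteq> []" "length p \<le> length a"
  shows "node_value f a (prefix_node p) \<longleftrightarrow> take (length p) a = p"
  using assms by (cases a; cases p) (auto simp: prefix_node_def)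

lemma take_length_snoc:
  assumes "length p < length a"
  shows "take (length (p @ [b])) a = p @ [b] \<longleftrightarrow> take (length p) a = p \<and> a ! length p = b"
  using assms by (simp add: take_Suc_conv_app_nth)

text \<open>At full length the prefix test forces \<open>p = a\<close>, so the leaf's choice by
  \<open>f p\<close> agrees with \<open>f a\<close>.\<close>

lemma node_value_result_node:
  assumes "p \<noteq> []" "length p \<le> length a"
  shows "node_value f a (result_node (length a) f p) \<longleftrightarrow> take (length p) a = p \<and> f a"
  using assms node_value_prefix_node[OF assms, of f] by (auto simp: result_node_def)

lemma outputs_tree_circuit:
  assumes "n \<ge> 1" "length a = n"
  shows "is_node n v \<Longrightarrow> outputs (tree_circuit n f) a v (node_value f a v)"
proof (induction v rule: measure_induct_rule[of "rank n"])
  case (less v)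
  have IH: "outputs (tree_circuit n f) a u (node_value f a u)"
    if "u \<in> preds (tree_gate n f v)" for u
    using less preds_tree_gate[OF assms(1) less.prems that] by blast
  show ?case
  proof (cases v)
    case (Var i)
    then show ?thesis using outputs.out_Input[of "tree_circuit n f" v i a] by simp
  next
    case (Neg i)
    then show ?thesis
      using outputs.out_Not[of "tree_circuit n f" v "Var i" a "node_value f a (Var i)"] IH by simp
  next
    case Zero
    then show ?thesis
      using outputs.out_And[of "tree_circuit n f" v "Var 0" "Neg 0" a "a ! 0" "\<not> a ! 0"]
        IH[of "Var 0"] IH[of "Neg 0"] by simp
  next
    case (Prefix p)
    then have len: "2 \<le> length p" "length p \<le> length a" using less.prems assms by auto
    define q where "q = butlast p"
    \<comment> \<open>Length at least 2 makes the shorter prefix nonempty, as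
      \<open>node_value_prefix_node\<close> demands.\<close>
    have p: "p = q @ [last p]" and "q \<noteq> []"
      using len by (cases p rule: rev_cases; force simp: q_def)+
    have q: "length p - 1 = length q" "length q < length a" using len by (auto simp: q_def)
    have "outputs (tree_circuit n f) a v
        (node_value f a (prefix_node q) \<and> node_value f a (literal (length p - 1) (last p)))"
      by (rule outputs.out_And[OF _ IH IH]) (simp_all add: Prefix q_def)
    moreover have "take (length p) a = p \<longleftrightarrow> take (length q) a = q \<and> a ! (length p - 1) = last p"
      using take_length_snoc[OF q(2), of "last p"] by (simp only: p[symmetric] q(1))
    ultimately show ?thesis
      using Prefix len \<open>q \<noteq> []\<close> by (simp add: node_value_prefix_node q_def)
  next
    case (Result p)
    then have len: "length p < length a" using less.prems assms by auto
    have "outputs (tree_circuit n f) a v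
        (node_value f a (result_node n f (p @ [False])) \<or>
         node_value f a (result_node n f (p @ [True])))"
      by (rule outputs.out_Or) (use IH Result in auto)
    \<comment> \<open>The two children differ only in the demanded bit \<open>b\<close>; exactly one
      of them matches \<open>a ! length p\<close>, so the disjunction drops this condition.\<close>
    moreover have "node_value f a (result_node n f (p @ [b])) \<longleftrightarrow>
        take (length p) a = p \<and> a ! length p = b \<and> f a" for b
      using node_value_result_node[of "p @ [b]" a f] take_length_snoc[OF len, of b] len assms(2)
      by (simp del: take_append)
    ultimately show ?thesis using Result by (cases "a ! length p") simp_all
  qed
qed

section \<open>Counting the firing gates\<close>

lemma EC_at_tree_circuit:
  assumes "n \<ge> 1" "length a = n"
  shows "EC_at (tree_circuit n f) a \<le> 3 * n - 1"
proof -
  let ?N = "Neg ` {..<n}"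
  let ?P = "(\<lambda>k. Prefix (take k a)) ` {2..n}"
  let ?R = "(\<lambda>k. Result (take k a)) ` {..<n}"
  have "v \<in> ?N \<union> ?P \<union> ?R"
    if "is_node n v" "\<not> is_input (tree_gate n f v)" "outputs (tree_circuit n f) a v True" for v
  proof -
    have "node_value f a v"
      using outputs_unique[OF that(3) outputs_tree_circuit[OF assms that(1)]] by simp
    \<comment> \<open>A firing \<open>Prefix p\<close> or \<open>Result p\<close> has
      \<open>p = take (length p) a\<close>, so each length contributes at most one gate of each
      kind; \<open>Zero\<close> has value \<open>False\<close>.\<close>
    then show ?thesis using that(1,2) by (cases v) (auto intro: rev_image_eqI)
  qed
  then have "EC_at (tree_circuit n f) a \<le> card (?N \<union> ?P \<union> ?R)"
    unfolding EC_at_def by (intro card_mono) auto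
  also have "\<dots> \<le> card ?N + card ?P + card ?R"
    by (meson card_Un_le add_right_mono order_trans)
  \<comment> \<open>All \<open>n\<close> negations are charged, whatever \<open>a\<close> is;
    \<open>Prefix\<close> lengths run from 2 to \<open>n\<close>, \<open>Result\<close> lengths from
    0 to \<open>n - 1\<close>.\<close>
  also have "\<dots> \<le> n + (n - 1) + n"
    using card_image_le[of "{..<n}" Neg] card_image_le[of "{2..n}" "\<lambda>k. Prefix (take k a)"]
      card_image_le[of "{..<n}" "\<lambda>k. Result (take k a)"]
    by simp
  finally show ?thesis using assms(1) by simp
qed

theorem proposition2p2:
  fixes n :: nat and f :: "bool list \<Rightarrow> bool"
  assumes "n \<ge> 1"
  shows "EC n f \<le> enat (3 * n - 1)"
proof (rule EC_le)
  show "is_circuit n (tree_circuit n f)" by (rule is_circuit_tree_circuit[OF assms])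
  show "computes n (tree_circuit n f) f"
    \<comment> \<open>At the root the prefix condition is trivial, leaving
      \<open>f a\<close>.\<close>
    using outputs_tree_circuit[OF assms, of _ "Result []" f] assms by (simp add: computes_def)
qed (rule EC_at_tree_circuit[OF assms])

end
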